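(* Let $f:[0,1]^d\to[-1,1]$ be Lipschitz continuous with Lipschitz constant $\ell$, i.e. $|f(\bm{x})-f(\bm{y})|\le \ell\|\bm{x}-\bm{y}\|_\infty$ for all $\bm{x},\bm{y}\in[0,1]^d$. For any $\varepsilon>0$ and $n\in\mathbb{N}$ there exists a PQC $W_b(\bm{x})$ such that $f_{W_b}(\bm{x}):=\langle 0|W_b^\dagger(\bm{x})Z^{(0)}W_b(\bm{x})|0\rangle$ satisfies $$|f(\bm{x})-f_{W_b}(\bm{x})|\le \varepsilon+2\Bigl(\bigl(1+\tfrac{\ell^2}{n\varepsilon^2}\bigr)^d-1\Bigr)\le \varepsilon+d2^d\frac{\ell^2}{n\varepsilon^2}$$ for all $\bm{x}\in[0,1]^d$. The width of the PQC is $O(d\log n)$, its depth is $O(dn^d\log n)$, and its number of parameters is $O(dn^d)$.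
   Context: $Z^{(0)}$ is the Pauli $Z$ observable on the first qubit and $|0\rangle$ the all-zeros state. A parameterized quantum circuit (PQC) with input $\bm{x}=(x_1,\dots,x_d)$ is a quantum circuit built from CNOT gates, Hadamard gates and single-qubit gates, where the single-qubit gates are either Pauli rotations $R_X(\theta)=e^{-i\theta X/2}$, $R_Y(\theta)$, $R_Z(\theta)=e^{-i\theta Z/2}$ with trainable real angles not depending on $\bm{x}$, or data-encoding gates $S(x_j)=e^{i\arccos(x_j)X}=\begin{pmatrix} x_j & i\sqrt{1-x_j^2}\\ i\sqrt{1-x_j^2} & x_j\end{pmatrix}$ for a coordinate $x_j\in[-1,1]$. Width = number of qubits, depth = circuit depth, number of parameters = number of trainable angles. Asymptotic bounds hold with absolute constants.
   Formalization: The middle inequality of the chain fails in general (e.g. d=2, ℓ=1, ε=1/2, n=1), so the error is instead shown to be at most each of the two displayed bounds separately; log n is read as 1+log₂ n so that the size bounds make sense at n=1, and d,n≥1. *)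

theory Defs
  imports Complex_Main
begin

text \<open>Qubits are numbered 0,1,...,w-1; qubit 0 is the "first qubit".
  A basis state of w qubits is an index k < 2^w, qubit q of k is bit q of k.
  The input is x :: nat => real with coordinates x 0, ..., x (d-1).\<close>

datatype gate =
    CNOT nat nat          \<comment> \<open>control, target\<close>
  | Had nat
  | RX nat real
  | RY nat real
  | RZ nat real
  | Enc nat nat           \<comment> \<open>Enc q j: data-encoding gate S(x_j) on qubit q\<close>

type_synonym state = "nat \<Rightarrow> complex"
type_synonym mat2 = "bool \<Rightarrow> bool \<Rightarrow> complex" \<comment> \<open>row (output bit), column (input bit)\<close>

definition gate_qubits :: "gate \<Rightarrow> nat set" where
  "gate_qubits g = (case g of CNOT c t \<Rightarrow> {c, t} | Had q \<Rightarrow> {q} | RX q _ \<Rightarrow> {q}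
     | RY q _ \<Rightarrow> {q} | RZ q _ \<Rightarrow> {q} | Enc q _ \<Rightarrow> {q})"

definition wf_gate :: "nat \<Rightarrow> nat \<Rightarrow> gate \<Rightarrow> bool" where
  "wf_gate w d g = ((\<forall>q\<in>gate_qubits g. q < w) \<and>
     (case g of CNOT c t \<Rightarrow> c \<noteq> t | Enc q j \<Rightarrow> j < d | _ \<Rightarrow> True))"

definition wf_pqc :: "nat \<Rightarrow> nat \<Rightarrow> gate list \<Rightarrow> bool" where
  "wf_pqc w d c = (\<forall>g\<in>set c. wf_gate w d g)"

definition RX_mat :: "real \<Rightarrow> mat2" where
  "RX_mat \<theta> a b = (if a = b then complex_of_real (cos (\<theta>/2)) else - \<i> * complex_of_real (sin (\<theta>/2)))"

definition RY_mat :: "real \<Rightarrow> mat2" where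
  "RY_mat \<theta> a b = complex_of_real (if a = b then cos (\<theta>/2) else if a then sin (\<theta>/2) else - sin (\<theta>/2))"

definition RZ_mat :: "real \<Rightarrow> mat2" where
  "RZ_mat \<theta> a b = (if a \<noteq> b then 0 else if a then exp (\<i> * complex_of_real (\<theta>/2))
                    else exp (- \<i> * complex_of_real (\<theta>/2)))"

definition H_mat :: mat2 where
  "H_mat a b = complex_of_real ((if a \<and> b then -1 else 1) / sqrt 2)"

text \<open>S(x) = exp(i arccos(x) X) = [[x, i sqrt(1-x^2)], [i sqrt(1-x^2), x]].\<close>
definition S_mat :: "real \<Rightarrow> mat2" where
  "S_mat x a b = (if a = b then complex_of_real x else \<i> * complex_of_real (sqrt (1 - x\<^sup>2)))"

definition apply1 :: "mat2 \<Rightarrow> nat \<Rightarrow> state \<Rightarrow> state" where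
  "apply1 U q \<psi> k = (\<Sum>b\<in>{False, True}. U (bit k q) b * \<psi> (if b then set_bit q k else unset_bit q k))"

definition apply_cnot :: "nat \<Rightarrow> nat \<Rightarrow> state \<Rightarrow> state" where
  "apply_cnot c t \<psi> k = \<psi> (if bit k c then flip_bit t k else k)"

definition apply_gate :: "(nat \<Rightarrow> real) \<Rightarrow> gate \<Rightarrow> state \<Rightarrow> state" where
  "apply_gate x g = (case g of
       CNOT c t \<Rightarrow> apply_cnot c t
     | Had q \<Rightarrow> apply1 H_mat q
     | RX q \<theta> \<Rightarrow> apply1 (RX_mat \<theta>) q
     | RY q \<theta> \<Rightarrow> apply1 (RY_mat \<theta>) q
     | RZ q \<theta> \<Rightarrow> apply1 (RZ_mat \<theta>) q
     | Enc q j \<Rightarrow> apply1 (S_mat (x j)) q)"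

definition run_pqc :: "gate list \<Rightarrow> (nat \<Rightarrow> real) \<Rightarrow> state" where
  "run_pqc c x = foldl (\<lambda>\<psi> g. apply_gate x g \<psi>) (\<lambda>k. if k = 0 then 1 else 0) c"

text \<open>f_W(x) = <0| W(x)^dagger Z^(0) W(x) |0> for a width-w circuit.\<close>
definition pqc_output :: "nat \<Rightarrow> gate list \<Rightarrow> (nat \<Rightarrow> real) \<Rightarrow> real" where
  "pqc_output w c x = (\<Sum>k<2^w. (if bit k 0 then -1 else 1) * (cmod (run_pqc c x k))\<^sup>2)"

definition is_param_gate :: "gate \<Rightarrow> bool" where
  "is_param_gate g = (case g of RX _ _ \<Rightarrow> True | RY _ _ \<Rightarrow> True | RZ _ _ \<Rightarrow> True | _ \<Rightarrow> False)"

definition num_params :: "gate list \<Rightarrow> nat" where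
  "num_params c = length (filter is_param_gate c)"

text \<open>Circuit depth: ASAP layering; each gate is placed in the layer one above the
  latest layer of the qubits it acts on.\<close>
definition layer_step :: "(nat \<Rightarrow> nat) \<Rightarrow> gate \<Rightarrow> (nat \<Rightarrow> nat)" where
  "layer_step L g = (let m = Suc (Max (L ` gate_qubits g)) in
                      (\<lambda>q. if q \<in> gate_qubits g then m else L q))"

definition circuit_depth :: "nat \<Rightarrow> gate list \<Rightarrow> nat" where
  "circuit_depth w c = Max (insert 0 (foldl layer_step (\<lambda>_. 0) c ` {..<w}))"

definition unit_cube :: "nat \<Rightarrow> (nat \<Rightarrow> real) set" where
  "unit_cube d = {x. \<forall>i<d. 0 \<le> x i \<and> x i \<le> 1}"

definition dist_inf :: "nat \<Rightarrow> (nat \<Rightarrow> real) \<Rightarrow> (nat \<Rightarrow> real) \<Rightarrow> real" where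
  "dist_inf d x y = Max (insert 0 ((\<lambda>i. \<bar>x i - y i\<bar>) ` {..<d}))"

end

theory Submission
  imports Defs
begin

text \<open>Since \<open>S(x) = RX(-2 arccos x)\<close>, encoding gates followed by rotations controlled by already
  prepared qubits realise an adaptive sampling process in which a bit is 0 with probability
  \<open>cos\<^sup>2 (r arccos x - \<alpha>)\<close>, where \<open>\<alpha>\<close> depends on the earlier bits. Semiclassical phase estimation of
  \<open>\<theta> = arccos x\<close> is of this form; with N grid points modulo \<open>pi\<close> the expectation of
  \<open>sin\<^sup>2 (\<theta> - estimate)\<close> is exactly \<open>sin\<^sup>2 (N (\<theta> - offset)) / N\<close>, by induction on the number of bits.
  Let \<open>2 ^ b \<le> n < 2 ^ (b + 1) = N\<close>. As only \<open>|cos|\<close> of the estimate matters, the N grid points fold to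
  \<open>2 ^ b\<close> values per coordinate, so the final table of angles \<open>arccos (f _)\<close>, applied to qubit 0, has at
  most \<open>n ^ d\<close> entries. The squared error of each coordinate has expectation at most \<open>1 / N < 1 / n\<close>, and
  a Chebyshev argument bounds the total error by \<open>\<epsilon> + 2 d L\<^sup>2 / (n \<epsilon>\<^sup>2)\<close>, which is below both
  required bounds.\<close>

section \<open>Uniformly controlled rotations\<close>

abbreviation run_from :: "(nat \<Rightarrow> real) \<Rightarrow> gate list \<Rightarrow> state \<Rightarrow> state" where
  "run_from x c \<psi> \<equiv> foldl (\<lambda>\<psi> g. apply_gate x g \<psi>) \<psi> c"

text \<open>Angle tables are functions of the whole basis index; this invariance says that controls
  on \<open>S\<close> suffice to implement them.\<close>

definition depends_only :: "nat set \<Rightarrow> (nat \<Rightarrow> 'a) \<Rightarrow> bool" where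
  "depends_only S \<alpha> \<longleftrightarrow> (\<forall>k k'. (\<forall>q\<in>S. bit k q = bit k' q) \<longrightarrow> \<alpha> k = \<alpha> k')"

lemma depends_onlyD: "depends_only S \<alpha> \<Longrightarrow> (\<And>q. q \<in> S \<Longrightarrow> bit k q = bit k' q) \<Longrightarrow> \<alpha> k = \<alpha> k'"
  unfolding depends_only_def by blast

lemma depends_onlyI:
  "(\<And>k k'. (\<And>q. q \<in> S \<Longrightarrow> bit k q = bit k' q) \<Longrightarrow> \<alpha> k = \<alpha> k') \<Longrightarrow> depends_only S \<alpha>"
  unfolding depends_only_def by blast

text \<open>Conjugating a Z-rotation by CNOT negates its angle when the control is set, so half sums
  and half differences of the two branches add up to the prescribed angle.\<close>
fun uc_rz :: "nat list \<Rightarrow> nat \<Rightarrow> (nat \<Rightarrow> real) \<Rightarrow> gate list" where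
  "uc_rz [] q \<alpha> = [RZ q (\<alpha> 0)]"
| "uc_rz (c # cs) q \<alpha> =
     uc_rz cs q (\<lambda>k. (\<alpha> (unset_bit c k) + \<alpha> (set_bit c k)) / 2) @ [CNOT c q] @
     uc_rz cs q (\<lambda>k. (\<alpha> (unset_bit c k) - \<alpha> (set_bit c k)) / 2) @ [CNOT c q]"

definition rz_phase :: "bool \<Rightarrow> real \<Rightarrow> complex" where
  "rz_phase a \<theta> = cis (if a then \<theta> / 2 else - \<theta> / 2)"

lemma RZ_mat_eq: "RZ_mat \<theta> a b = (if a = b then rz_phase a \<theta> else 0)"
  by (simp add: RZ_mat_def rz_phase_def cis_conv_exp)

lemma rz_phase_add: "rz_phase a \<theta> * rz_phase a \<theta>' = rz_phase a (\<theta> + \<theta>')"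
  by (simp add: rz_phase_def cis_mult add_divide_distrib diff_divide_distrib)

lemma rz_phase_not: "rz_phase (\<not> a) \<theta> = rz_phase a (- \<theta>)"
  by (simp add: rz_phase_def)

lemma set_bit_same: "bit k q \<Longrightarrow> set_bit q k = (k::nat)"
  by (rule bit_eqI) (auto simp: bit_set_bit_iff)

lemma unset_bit_same: "\<not> bit k q \<Longrightarrow> unset_bit q k = (k::nat)"
  by (rule bit_eqI) (auto simp: bit_unset_bit_iff)

lemma unset_set_bit: "unset_bit q (set_bit q k) = unset_bit q (k::nat)"
  by (rule bit_eqI) (auto simp: bit_unset_bit_iff bit_set_bit_iff)

lemma unset_unset_bit: "unset_bit q (unset_bit q k) = unset_bit q (k::nat)"
  by (rule bit_eqI) (auto simp: bit_unset_bit_iff)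

lemma set_unset_bit: "set_bit q (unset_bit q k) = set_bit q (k::nat)"
  by (rule bit_eqI) (auto simp: bit_unset_bit_iff bit_set_bit_iff)

text \<open>The CNOT pair cancels as a permutation of basis states, so the circuit stays diagonal,
  and a set control only flips the sign of the half difference.\<close>

lemma run_uc_rz:
  assumes "q \<notin> set cs" "depends_only (set cs) \<alpha>"
  shows "run_from x (uc_rz cs q \<alpha>) \<psi> k = rz_phase (bit k q) (\<alpha> k) * \<psi> k"
  using assms
proof (induction cs arbitrary: \<alpha> \<psi> k)
  case Nil
  have "\<alpha> 0 = \<alpha> k" using Nil(2) by (rule depends_onlyD) simp
  then show ?case
    by (auto simp: apply_gate_def apply1_def RZ_mat_eq set_bit_same unset_bit_same)
next
  case (Cons c cs)
  define \<beta> where "\<beta> = (\<lambda>k. (\<alpha> (unset_bit c k) + \<alpha> (set_bit c k)) / 2)"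
  define \<gamma> where "\<gamma> = (\<lambda>k. (\<alpha> (unset_bit c k) - \<alpha> (set_bit c k)) / 2)"
  have ne: "c \<noteq> q" "q \<notin> set cs" using Cons.prems by auto
  have dep: "\<alpha> (unset_bit c k) = \<alpha> (unset_bit c k')" "\<alpha> (set_bit c k) = \<alpha> (set_bit c k')"
    if "\<And>p. p \<in> set cs \<Longrightarrow> bit k p = bit k' p" for k k'
    using that
    by (auto intro!: depends_onlyD[OF Cons.prems(2)] simp: bit_set_bit_iff bit_unset_bit_iff)
  have d\<beta>: "depends_only (set cs) \<beta>"
  proof (rule depends_onlyI)
    fix k k' :: nat assume "\<And>p. p \<in> set cs \<Longrightarrow> bit k p = bit k' p"
    from dep[OF this] show "\<beta> k = \<beta> k'" by (simp add: \<beta>_def)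
  qed
  have d\<gamma>: "depends_only (set cs) \<gamma>"
  proof (rule depends_onlyI)
    fix k k' :: nat assume "\<And>p. p \<in> set cs \<Longrightarrow> bit k p = bit k' p"
    from dep[OF this] show "\<gamma> k = \<gamma> k'" by (simp add: \<gamma>_def)
  qed
  \<comment> \<open>The final CNOT reads the state at \<open>k'\<close>; by \<open>inv\<close> the
    earlier CNOT leads from there back to \<open>k\<close>.\<close>
  define k' where "k' = (if bit k c then flip_bit q k else k)"
  have b': "bit k' p = (if p = q \<and> bit k c then \<not> bit k q else bit k p)" for p
    by (auto simp: k'_def bit_flip_bit_iff)
  have inv: "(if bit k' c then flip_bit q k' else k') = k"
    by (rule bit_eqI) (use ne in \<open>auto simp: b' bit_flip_bit_iff\<close>)
  have \<gamma>: "\<gamma> k' = \<gamma> k"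
    by (rule depends_onlyD[OF d\<gamma>]) (use ne in \<open>auto simp: b'\<close>)
  have "run_from x (uc_rz (c # cs) q \<alpha>) \<psi> k =
      rz_phase (bit k' q) (\<gamma> k') * (rz_phase (bit k q) (\<beta> k) * \<psi> k)"
    using Cons.IH[OF ne(2) d\<beta>] Cons.IH[OF ne(2) d\<gamma>] inv
    unfolding uc_rz.simps \<beta>_def[symmetric] \<gamma>_def[symmetric]
    by (simp add: apply_gate_def apply_cnot_def k'_def[symmetric])
  also have "\<dots> = rz_phase (bit k q) (\<beta> k + (if bit k c then - \<gamma> k else \<gamma> k)) * \<psi> k"
    unfolding \<gamma> mult.assoc[symmetric] using ne
    by (auto simp: b' rz_phase_not rz_phase_add add.commute)
  also have "\<beta> k + (if bit k c then - \<gamma> k else \<gamma> k) = \<alpha> k"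
    by (simp add: \<beta>_def \<gamma>_def set_bit_same unset_bit_same field_simps)
  finally show ?case .
qed

section \<open>Adaptive sampling steps\<close>

datatype step = Step (starget: nat) (scoord: nat) (sreps: nat) (sctrls: "nat list") (sangle: "nat \<Rightarrow> real")

text \<open>The Hadamard gates turn the multiplexed Z-rotation into an X-rotation by an angle
  depending on the controls. It shares its axis with the encoding gates, so the angles combine into
  the single \<open>step_phase\<close>.\<close>

definition step_circ :: "step \<Rightarrow> gate list" where
  "step_circ s = replicate (sreps s) (Enc (starget s) (scoord s)) @ [Had (starget s)] @
     uc_rz (sctrls s) (starget s) (sangle s) @ [Had (starget s)]"

definition wf_step :: "nat \<Rightarrow> nat \<Rightarrow> step \<Rightarrow> bool" where
  "wf_step w d s \<longleftrightarrow> starget s < w \<and> scoord s < d \<and> (\<forall>c\<in>set (sctrls s). c < w) \<and>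
     starget s \<notin> set (sctrls s) \<and> depends_only (set (sctrls s)) (sangle s)"

definition step_phase :: "(nat \<Rightarrow> real) \<Rightarrow> step \<Rightarrow> nat \<Rightarrow> real" where
  "step_phase x s k = real (sreps s) * arccos (x (scoord s)) - sangle s k / 2"

text \<open>Views a state as a family of one-qubit vectors \<open>v\<close>, indexed by the
  remaining bits, so that a gate becomes a 2 by 2 matrix product.\<close>

lemma apply1_product:
  assumes "\<And>k. \<psi> k = v (unset_bit q k) (bit k q)"
  shows "apply1 U q \<psi> k =
    U (bit k q) False * v (unset_bit q k) False + U (bit k q) True * v (unset_bit q k) True"
  by (simp add: apply1_def assms unset_set_bit unset_unset_bit bit_set_bit_iff bit_unset_bit_iff)

text \<open>Each encoding gate rotates by \<open>arccos (x j)\<close> about the same axis, and the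
  addition theorems for sine and cosine add these angles up.\<close>

lemma run_enc:
  assumes \<psi>: "\<And>k. bit k q \<Longrightarrow> \<psi> k = 0" and x: "-1 \<le> x j" "x j \<le> 1"
  shows "run_from x (replicate r (Enc q j)) \<psi> k =
    (if bit k q then \<i> * of_real (sin (real r * arccos (x j))) else of_real (cos (real r * arccos (x j))))
      * \<psi> (unset_bit q k)"
proof (induction r arbitrary: k)
  case 0
  then show ?case using \<psi> by (auto simp: unset_bit_same)
next
  case (Suc r)
  define \<theta> where "\<theta> = arccos (x j)"
  have S: "S_mat (x j) a b = (if a = b then of_real (cos \<theta>) else \<i> * of_real (sin \<theta>))" for a b
    using x by (simp add: S_mat_def \<theta>_def sin_arccos)
  let ?v = "\<lambda>k b. (if b then \<i> * of_real (sin (real r * \<theta>)) else of_real (cos (real r * \<theta>))) * \<psi> k"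
  have "run_from x (replicate (Suc r) (Enc q j)) \<psi> k =
      apply1 (S_mat (x j)) q (run_from x (replicate r (Enc q j)) \<psi>) k"
    unfolding replicate_Suc replicate_append_same[symmetric] by (simp add: apply_gate_def)
  also have "\<dots> = S_mat (x j) (bit k q) False * ?v (unset_bit q k) False +
      S_mat (x j) (bit k q) True * ?v (unset_bit q k) True"
    by (rule apply1_product) (simp add: Suc.IH \<theta>_def)
  finally show ?case
    unfolding \<theta>_def[symmetric]
    by (simp add: S distrib_right sin_add cos_add algebra_simps)
qed

text \<open>Between the two Hadamard gates the encoded angle and the controlled rotation are both
  relative phases and simply add. Euler's formula turns the sum back into cosine and sine.\<close>

lemma run_step:
  assumes s: "wf_step w d s" and \<psi>: "\<And>k. bit k (starget s) \<Longrightarrow> \<psi> k = 0"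
    and x: "-1 \<le> x (scoord s)" "x (scoord s) \<le> 1"
  shows "run_from x (step_circ s) \<psi> k =
    (if bit k (starget s) then \<i> * of_real (sin (step_phase x s k)) else of_real (cos (step_phase x s k)))
      * \<psi> (unset_bit (starget s) k)"
proof -
  define q where "q = starget s"
  define \<theta> where "\<theta> = real (sreps s) * arccos (x (scoord s))"
  define \<alpha> where "\<alpha> = sangle s"
  define u where "u = (\<lambda>k b. (if b then \<i> * of_real (sin \<theta>) else of_real (cos \<theta>)) * \<psi> k)"
  define \<psi>1 where "\<psi>1 = run_from x (replicate (sreps s) (Enc q (scoord s))) \<psi>"
  define \<psi>2 where "\<psi>2 = apply1 H_mat q \<psi>1"
  define \<psi>3 where "\<psi>3 = run_from x (uc_rz (sctrls s) q \<alpha>) \<psi>2"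
  have \<psi>1: "\<psi>1 k = u (unset_bit q k) (bit k q)" for k
    unfolding \<psi>1_def u_def \<theta>_def
    by (subst run_enc) (use \<psi> x in \<open>auto simp: q_def\<close>)
  have c45: "complex_of_real (1 / sqrt 2) * complex_of_real (1 / sqrt 2) = 1 / 2"
    unfolding of_real_mult[symmetric] by simp
  define h where "h = complex_of_real (1 / sqrt 2)"
  have hh: "h * h = 1 / 2" using c45 by (simp add: h_def)
  have H: "H_mat a b = (if a \<and> b then - h else h)" for a b
    by (simp add: H_mat_def h_def)
  have \<psi>2: "\<psi>2 k = h * cis (if bit k q then - \<theta> else \<theta>) * \<psi> (unset_bit q k)" for k
    unfolding \<psi>2_def
    by (subst apply1_product[where \<psi> = \<psi>1 and v = u, OF \<psi>1]) (simp add: H u_def cis.ctr complex_eq_iff algebra_simps)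
  have qn: "q \<notin> set (sctrls s)" and dep: "depends_only (set (sctrls s)) \<alpha>"
    using s by (auto simp: wf_step_def q_def \<alpha>_def)
  have \<alpha>: "\<alpha> (unset_bit q k) = \<alpha> k" for k
    by (rule depends_onlyD[OF dep]) (use qn in \<open>auto simp: bit_unset_bit_iff\<close>)
  define v where "v = (\<lambda>k b. h * cis (if b then \<alpha> k / 2 - \<theta> else \<theta> - \<alpha> k / 2) * \<psi> k)"
  have euler: "cis t + (if b then - 1 else 1) * cis (- t) =
      2 * (if b then \<i> * of_real (sin t) else of_real (cos t))" for t b
    by (simp add: complex_eq_iff)
  have merge: "cis a * (h * cis b * y) = h * cis (a + b) * y" for a b y
    by (simp add: mult_ac flip: cis_mult)
  have \<psi>3: "\<psi>3 k = v (unset_bit q k) (bit k q)" for k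
    unfolding \<psi>3_def run_uc_rz[OF qn dep] \<psi>2 v_def \<alpha> rz_phase_def by (simp add: merge)
  have "run_from x (step_circ s) \<psi> k = apply1 H_mat q \<psi>3 k"
    by (simp add: step_circ_def \<psi>3_def \<psi>2_def \<psi>1_def q_def \<alpha>_def apply_gate_def)
  also have "\<dots> = H_mat (bit k q) False * v (unset_bit q k) False +
      H_mat (bit k q) True * v (unset_bit q k) True"
    by (rule apply1_product[where \<psi> = \<psi>3 and v = v, OF \<psi>3])
  also have "\<dots> = h * h * (cis (\<theta> - \<alpha> k / 2) + (if bit k q then - 1 else 1) * cis (- (\<theta> - \<alpha> k / 2)))
      * \<psi> (unset_bit q k)"
    by (simp add: H v_def \<alpha> algebra_simps)
  also have "h * h * (cis (\<theta> - \<alpha> k / 2) + (if bit k q then - 1 else 1) * cis (- (\<theta> - \<alpha> k / 2))) =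
     (if bit k q then \<i> * of_real (sin (\<theta> - \<alpha> k / 2)) else of_real (cos (\<theta> - \<alpha> k / 2)))"
    unfolding hh euler by simp
  finally show ?thesis by (simp add: step_phase_def q_def \<theta>_def \<alpha>_def)
qed

text \<open>Sampled qubits are never touched again except as controls, so expectations of diagonal
  observables can be computed backwards as for a classical adaptive random process.\<close>
fun wp :: "(nat \<Rightarrow> real) \<Rightarrow> step list \<Rightarrow> (nat \<Rightarrow> real) \<Rightarrow> nat \<Rightarrow> real" where
  "wp x [] G k = G k"
| "wp x (s # ss) G k = (cos (step_phase x s k))\<^sup>2 * wp x ss G k +
     (sin (step_phase x s k))\<^sup>2 * wp x ss G (set_bit (starget s) k)"

lemma set_bit_less: "q < w \<Longrightarrow> k < 2 ^ w \<Longrightarrow> set_bit q k < (2::nat) ^ w"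
  unfolding take_bit_nat_eq_self_iff[symmetric] by (simp add: take_bit_set_bit_eq)

lemma unset_bit_less: "q < w \<Longrightarrow> k < 2 ^ w \<Longrightarrow> unset_bit q k < (2::nat) ^ w"
  unfolding take_bit_nat_eq_self_iff[symmetric] by (simp add: take_bit_unset_bit_eq)

lemma sum_split_bit:
  fixes h :: "nat \<Rightarrow> real"
  assumes "q < w"
  shows "(\<Sum>k<2^w. h k) = (\<Sum>k\<in>{k. k < 2^w \<and> \<not> bit k q}. h k + h (set_bit q k))"
proof -
  have "{..<2^w} = {k. k < 2^w \<and> \<not> bit k q} \<union> {k. k < (2::nat)^w \<and> bit k q}" by auto
  then have "(\<Sum>k<2^w. h k) = (\<Sum>k\<in>{k. k < 2^w \<and> \<not> bit k q}. h k) + (\<Sum>k\<in>{k. k < 2^w \<and> bit k q}. h k)"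
    by (simp only:) (rule sum.union_disjoint, auto)
  also have "(\<Sum>k\<in>{k. k < 2^w \<and> bit k q}. h k) = (\<Sum>k\<in>{k. k < 2^w \<and> \<not> bit k q}. h (set_bit q k))"
    by (rule sum.reindex_bij_witness[of _ "set_bit q" "unset_bit q"])
      (use assms in \<open>simp_all add: unset_set_bit set_unset_bit unset_bit_same set_bit_same
        set_bit_less unset_bit_less bit_set_bit_iff bit_unset_bit_iff\<close>)
  finally show ?thesis by (simp add: sum.distrib)
qed

text \<open>Since the target starts in the zero state, each new amplitude has the single predecessor
  \<open>unset_bit q k\<close>. There is no interference, and squared moduli split into cosine and
  sine squared parts, which is one unfolding of \<open>wp\<close>.\<close>

lemma run_steps_expectation:
  assumes "\<And>s. s \<in> set ss \<Longrightarrow> wf_step w d s" "distinct (map starget ss)"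
    "\<And>k s. s \<in> set ss \<Longrightarrow> bit k (starget s) \<Longrightarrow> \<psi> k = 0"
    "\<And>j. j < d \<Longrightarrow> -1 \<le> x j \<and> x j \<le> 1"
  shows "(\<Sum>k<2^w. G k * (cmod (run_from x (concat (map step_circ ss)) \<psi> k))\<^sup>2) =
    (\<Sum>k<2^w. wp x ss G k * (cmod (\<psi> k))\<^sup>2)"
  using assms(1-3)
proof (induction ss arbitrary: \<psi>)
  case (Cons s ss)
  define q where "q = starget s"
  define \<psi>' where "\<psi>' = run_from x (step_circ s) \<psi>"
  have q: "q < w" and ws: "wf_step w d s" and sd: "scoord s < d"
    using Cons.prems(1)[of s] by (auto simp: q_def wf_step_def)
  have z: "\<psi> k = 0" if "bit k q" for k using that Cons.prems(3)[of s k] by (simp add: q_def)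
  have \<psi>': "\<psi>' k = (if bit k q then \<i> * of_real (sin (step_phase x s k)) else of_real (cos (step_phase x s k)))
      * \<psi> (unset_bit q k)" for k
    unfolding \<psi>'_def q_def by (rule run_step[OF ws]) (use z assms(4)[OF sd] in \<open>auto simp: q_def\<close>)
  have ph: "step_phase x s (set_bit q k) = step_phase x s k" for k
    unfolding step_phase_def using ws
    by (auto intro!: arg_cong[where f="\<lambda>t. _ - t / 2"] elim!: depends_onlyD
        simp: wf_step_def bit_set_bit_iff q_def)
  have "(\<Sum>k<2^w. G k * (cmod (run_from x (concat (map step_circ (s # ss))) \<psi> k))\<^sup>2) =
     (\<Sum>k<2^w. G k * (cmod (run_from x (concat (map step_circ ss)) \<psi>' k))\<^sup>2)"
    by (simp add: \<psi>'_def)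
  also have "\<dots> = (\<Sum>k<2^w. wp x ss G k * (cmod (\<psi>' k))\<^sup>2)"
  proof (rule Cons.IH)
    \<comment> \<open>Later targets differ from \<open>q\<close>, so they are still in the zero
      state after this step.\<close>
    fix k :: "nat" and t assume t: "t \<in> set ss" "bit k (starget t)"
    then have "starget t \<noteq> q" using Cons.prems(2) by (auto simp: q_def image_iff)
    with t have "\<psi> (unset_bit q k) = 0"
      using Cons.prems(3)[of t "unset_bit q k"] by (simp add: bit_unset_bit_iff)
    then show "\<psi>' k = 0" by (simp add: \<psi>')
  qed (use Cons.prems in auto)
  also have "\<dots> = (\<Sum>k\<in>{k. k < 2^w \<and> \<not> bit k q}. wp x ss G k * (cmod (\<psi>' k))\<^sup>2 +
      wp x ss G (set_bit q k) * (cmod (\<psi>' (set_bit q k)))\<^sup>2)"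
    by (rule sum_split_bit[OF q])
  also have "\<dots> = (\<Sum>k\<in>{k. k < 2^w \<and> \<not> bit k q}. wp x (s # ss) G k * (cmod (\<psi> k))\<^sup>2 +
      wp x (s # ss) G (set_bit q k) * (cmod (\<psi> (set_bit q k)))\<^sup>2)"
  proof (rule sum.cong[OF refl])
    fix k :: nat assume "k \<in> {k. k < 2^w \<and> \<not> bit k q}"
    then have k: "\<not> bit k q" by simp
    have "cmod (\<psi>' k) = \<bar>cos (step_phase x s k)\<bar> * cmod (\<psi> k)"
      "cmod (\<psi>' (set_bit q k)) = \<bar>sin (step_phase x s k)\<bar> * cmod (\<psi> k)"
      "\<psi> (set_bit q k) = 0"
      using k by (simp_all add: \<psi>' ph z unset_set_bit unset_bit_same bit_set_bit_iff norm_mult)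
    then show "wp x ss G k * (cmod (\<psi>' k))\<^sup>2 + wp x ss G (set_bit q k) * (cmod (\<psi>' (set_bit q k)))\<^sup>2 =
        wp x (s # ss) G k * (cmod (\<psi> k))\<^sup>2 + wp x (s # ss) G (set_bit q k) * (cmod (\<psi> (set_bit q k)))\<^sup>2"
      by (simp only:) (simp add: power_mult_distrib q_def algebra_simps)
  qed
  also have "\<dots> = (\<Sum>k<2^w. wp x (s # ss) G k * (cmod (\<psi> k))\<^sup>2)"
    by (rule sum_split_bit[OF q, symmetric])
  finally show ?case .
qed simp

lemma pqc_output_steps:
  assumes "\<And>s. s \<in> set ss \<Longrightarrow> wf_step w d s" "distinct (map starget ss)"
    "\<And>j. j < d \<Longrightarrow> -1 \<le> x j \<and> x j \<le> 1"
  shows "pqc_output w (concat (map step_circ ss)) x = wp x ss (\<lambda>k. if bit k 0 then -1 else 1) 0"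
proof -
  have "pqc_output w (concat (map step_circ ss)) x =
    (\<Sum>k<2^w. wp x ss (\<lambda>k. if bit k 0 then -1 else 1) k * (cmod (if k = 0 then 1 else 0))\<^sup>2)"
    unfolding pqc_output_def run_pqc_def
    by (rule run_steps_expectation[where d = d]) (use assms in \<open>auto intro!: gr0I\<close>)
  also have "\<dots> = (\<Sum>k<2^w. if k = 0 then wp x ss (\<lambda>k. if bit k 0 then -1 else 1) k else 0)"
    by (rule sum.cong) auto
  finally show ?thesis by simp
qed

section \<open>Calculus of backward expectations\<close>

lemma wp_append: "wp x (ss @ ts) G = wp x ss (wp x ts G)"
proof
  show "wp x (ss @ ts) G k = wp x ss (wp x ts G) k" for k
    by (induction ss arbitrary: k) auto
qed

lemma wp_const: "wp x ss (\<lambda>_. c) k = c"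
  by (induction ss arbitrary: k) (auto simp flip: distrib_right)

lemma wp_affine: "wp x ss (\<lambda>k. a + b * G k) k = a + b * wp x ss G k"
proof (induction ss arbitrary: k)
  case (Cons s ss)
  have "(cos (step_phase x s k))\<^sup>2 * a + (sin (step_phase x s k))\<^sup>2 * a = a"
    by (simp flip: distrib_right)
  then show ?case by (simp add: Cons algebra_simps)
qed simp

lemma wp_sum: "wp x ss (\<lambda>k. \<Sum>j\<in>A. G j k) k = (\<Sum>j\<in>A. wp x ss (G j) k)"
  by (induction ss arbitrary: k) (auto simp: sum_distrib_left sum.distrib)

text \<open>Only indices reachable from \<open>k\<close> need comparing. This restriction later
  supplies the fact that qubits not yet sampled are still 0.\<close>

lemma wp_mono:
  assumes "\<And>k'. (\<And>q. bit k' q \<Longrightarrow> bit k q \<or> q \<in> starget ` set ss) \<Longrightarrow> G k' \<le> H k'"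
  shows "wp x ss G k \<le> wp x ss H k"
  using assms
proof (induction ss arbitrary: k)
  case (Cons s ss)
  have "wp x ss G k \<le> wp x ss H k"
    by (rule Cons.IH, rule Cons.prems) auto
  moreover have "wp x ss G (set_bit (starget s) k) \<le> wp x ss H (set_bit (starget s) k)"
    by (rule Cons.IH, rule Cons.prems) (auto simp: bit_set_bit_iff)
  ultimately show ?case by (auto intro!: add_mono mult_left_mono)
qed simp

lemma wp_cong:
  assumes "\<And>k'. (\<And>q. bit k' q \<Longrightarrow> bit k q \<or> q \<in> starget ` set ss) \<Longrightarrow> G k' = H k'"
  shows "wp x ss G k = wp x ss H k"
  by (rule antisym; rule wp_mono) (use assms in auto)

text \<open>Both branches of every step give the same value of \<open>G\<close>, and their
  probabilities add up to 1.\<close>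

lemma wp_irrelevant:
  assumes "depends_only S G" "S \<inter> starget ` set ss = {}"
  shows "wp x ss G k = G k"
  using assms(2)
proof (induction ss arbitrary: k)
  case (Cons s ss)
  have "G (set_bit (starget s) k) = G k"
    by (rule depends_onlyD[OF assms(1)]) (use Cons.prems in \<open>auto simp: bit_set_bit_iff\<close>)
  with Cons show ?case by (simp flip: distrib_right)
qed simp

section \<open>Phase estimation with a folded register\<close>

text \<open>The right side minus the left side equals
  \<open>2 * cos a * cos b * (1 - cos (a - b))\<close>.\<close>

lemma cos_diff_square_le:
  fixes a b :: real
  assumes "0 \<le> cos a" "0 \<le> cos b"
  shows "(cos a - cos b)\<^sup>2 \<le> (sin (a - b))\<^sup>2"
proof -
  define p where "p = cos a * cos b"
  define s where "s = sin a * sin b"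
  have c: "p + s = cos (a - b)" by (simp add: p_def s_def cos_diff)
  have "s\<^sup>2 = (1 - (cos a)\<^sup>2) * (1 - (cos b)\<^sup>2)"
    by (simp add: s_def power_mult_distrib sin_squared_eq)
  then have "(cos a)\<^sup>2 + (cos b)\<^sup>2 = 1 + p\<^sup>2 - s\<^sup>2"
    by (simp add: p_def power_mult_distrib algebra_simps)
  then have 1: "(cos a - cos b)\<^sup>2 = 1 + p\<^sup>2 - s\<^sup>2 - 2 * p"
    by (simp add: power2_diff p_def)
  have 2: "(sin (a - b))\<^sup>2 = 1 - (p + s)\<^sup>2"
    by (simp add: c sin_squared_eq)
  have "p * (p + s) \<le> p * 1"
    by (rule mult_left_mono) (use assms c cos_le_one[of "a - b"] in \<open>auto simp: p_def\<close>)
  then show ?thesis unfolding 1 2 by (simp add: power2_eq_square algebra_simps)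
qed

text \<open>Qubit 0 is reserved for the output. Each coordinate then owns \<open>2 * b + 1\<close>
  consecutive qubits: \<open>b + 1\<close> bits of the phase estimate, least significant first,
  followed by \<open>b\<close> folded bits.\<close>

definition reg_qubit :: "nat \<Rightarrow> nat \<Rightarrow> nat \<Rightarrow> nat" where
  "reg_qubit b j i = 1 + j * (2 * b + 1) + i"

definition fold_qubit :: "nat \<Rightarrow> nat \<Rightarrow> nat \<Rightarrow> nat" where
  "fold_qubit b j i = reg_qubit b j (b + 1 + i)"

lemma reg_qubit_inj:
  assumes "i < 2 * b + 1" "i' < 2 * b + 1"
  shows "reg_qubit b j i = reg_qubit b j' i' \<longleftrightarrow> j = j' \<and> i = i'"
proof
  assume eq: "reg_qubit b j i = reg_qubit b j' i'"
  have "(j * (2 * b + 1) + i) div (2 * b + 1) = j" "(j' * (2 * b + 1) + i') div (2 * b + 1) = j'"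
    "(j * (2 * b + 1) + i) mod (2 * b + 1) = i" "(j' * (2 * b + 1) + i') mod (2 * b + 1) = i'"
    using assms by (simp_all del: add_Suc_right mult_Suc_right)
  with eq show "j = j' \<and> i = i'"
    unfolding reg_qubit_def by (metis add.assoc add_left_cancel)
qed auto

text \<open>Estimate of the angle from the first m measured bits. The half-cell offset makes the grid
  symmetric about \<open>pi / 2\<close>, with complementing all bits as its reflection.\<close>
definition angle_est :: "nat \<Rightarrow> nat \<Rightarrow> nat \<Rightarrow> nat \<Rightarrow> real" where
  "angle_est b j m k = pi / 2 ^ (b + 2) + (\<Sum>i<m. if bit k (reg_qubit b j i) then pi / 2 ^ (b + 1 - i) else 0)"

text \<open>The weights are those of \<open>angle_est\<close> without the top bit, whose weight is
  \<open>pi / 2\<close>; hence the value stays in the first quadrant.\<close>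

definition folded_est :: "nat \<Rightarrow> nat \<Rightarrow> nat \<Rightarrow> real" where
  "folded_est b j k = pi / 2 ^ (b + 2) + (\<Sum>i<b. if bit k (fold_qubit b j i) then pi / 2 ^ (b + 1 - i) else 0)"

text \<open>Bit \<open>i\<close> has weight \<open>pi / 2 ^ (b + 1 - i)\<close>, which the factor
  \<open>2 ^ (b - i)\<close> scales to a quarter turn. The leading 2 compensates the halving in
  \<open>step_phase\<close>.\<close>

definition phase_step :: "nat \<Rightarrow> nat \<Rightarrow> nat \<Rightarrow> step" where
  "phase_step b j i = Step (reg_qubit b j i) j (2 ^ (b - i)) (map (reg_qubit b j) [0..<i])
     (\<lambda>k. 2 * 2 ^ (b - i) * angle_est b j i k)"

text \<open>A deterministic step: without encoding gates, angle \<open>pi\<close> sets the bit with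
  certainty and angle 0 leaves it 0. It thus stores the exclusive or of bit \<open>i\<close> with
  the top bit, complementing the low bits in the upper half of the grid.\<close>

definition fold_step :: "nat \<Rightarrow> nat \<Rightarrow> nat \<Rightarrow> step" where
  "fold_step b j i = Step (fold_qubit b j i) j 0 [reg_qubit b j i, reg_qubit b j b]
     (\<lambda>k. if bit k (reg_qubit b j i) \<noteq> bit k (reg_qubit b j b) then pi else 0)"

definition block :: "nat \<Rightarrow> nat \<Rightarrow> step list" where
  "block b j = map (phase_step b j) [0..<b + 1] @ map (fold_step b j) [0..<b]"

lemma starget_phase_step [simp]: "starget (phase_step b j i) = reg_qubit b j i"
  by (simp add: phase_step_def)

lemma starget_fold_step [simp]: "starget (fold_step b j i) = fold_qubit b j i"
  by (simp add: fold_step_def)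

text \<open>Semiclassical phase estimation, least significant bit first: fixing one bit turns the
  problem with \<open>2 * N\<close> grid points into the one with N grid points for a shifted angle.\<close>
lemma wp_phase_steps:
  assumes "i \<le> b + 1" "\<And>i'. i \<le> i' \<Longrightarrow> i' \<le> b \<Longrightarrow> \<not> bit k (reg_qubit b j i')"
  shows "wp x (map (phase_step b j) [i..<b + 1]) (\<lambda>k. (sin (arccos (x j) - angle_est b j (b + 1) k))\<^sup>2) k
    = (sin (2 ^ (b + 1 - i) * (arccos (x j) - angle_est b j (b + 1) k)))\<^sup>2 / 2 ^ (b + 1 - i)"
  using assms
proof (induction "b + 1 - i" arbitrary: i k)
  case 0
  then show ?case by simp
next
  case (Suc m)
  from Suc.hyps(2) have i: "i < b + 1" "i \<le> b" and m: "m = b + 1 - Suc i" "b - i = m" by auto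
  define e where "e = angle_est b j (b + 1) k"
  define u where "u = arccos (x j) - e"
  define N :: real where "N = 2 ^ m"
  have N0: "N > 0" by (simp add: N_def)
  have NN: "(2::real) ^ (b + 1 - i) = 2 * N" using i m by (simp add: N_def Suc_diff_le)
  \<comment> \<open>The bits from \<open>i\<close> on are still 0, so truncating the estimate
    changes nothing.\<close>
  have e: "angle_est b j i k = e"
    unfolding angle_est_def e_def
    by (intro arg_cong2[where f = "(+)"] refl sum.mono_neutral_left) (use Suc.prems i in auto)
  have e': "angle_est b j (b + 1) (set_bit (reg_qubit b j i) k) = e + pi / (2 * N)"
  proof -
    have "angle_est b j (b + 1) (set_bit (reg_qubit b j i) k) = pi / 2 ^ (b + 2) +
      (\<Sum>i'<b+1. (if bit k (reg_qubit b j i') then pi / 2 ^ (b + 1 - i') else 0) +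
        (if i' = i then pi / 2 ^ (b + 1 - i) else 0))"
      unfolding angle_est_def
      by (intro arg_cong2[where f = "(+)"] refl sum.cong)
        (use Suc.prems i in \<open>auto simp: bit_set_bit_iff reg_qubit_inj\<close>)
    also have "\<dots> = e + pi / 2 ^ (b + 1 - i)"
      using i by (simp add: sum.distrib e_def angle_est_def)
    finally show ?thesis by (simp only: NN)
  qed
  have ph: "step_phase x (phase_step b j i) k = N * u"
    by (simp add: step_phase_def phase_step_def e m(2) N_def u_def algebra_simps)
  have IH: "wp x (map (phase_step b j) [Suc i..<b + 1])
      (\<lambda>k. (sin (arccos (x j) - angle_est b j (b + 1) k))\<^sup>2) k' =
      (sin (N * (arccos (x j) - angle_est b j (b + 1) k')))\<^sup>2 / N"
    if "\<And>i'. Suc i \<le> i' \<Longrightarrow> i' \<le> b \<Longrightarrow> \<not> bit k' (reg_qubit b j i')" for k'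
    unfolding N_def m using that i m(1) by (intro Suc.hyps(1)) auto
  have IH0: "wp x (map (phase_step b j) [Suc i..<b + 1])
      (\<lambda>k. (sin (arccos (x j) - angle_est b j (b + 1) k))\<^sup>2) k = (sin (N * u))\<^sup>2 / N"
    using IH[of k] Suc.prems(2) by (simp add: u_def e_def)
  have "wp x (map (phase_step b j) [Suc i..<b + 1])
      (\<lambda>k. (sin (arccos (x j) - angle_est b j (b + 1) k))\<^sup>2) (set_bit (reg_qubit b j i) k) =
      (sin (N * (arccos (x j) - (e + pi / (2 * N)))))\<^sup>2 / N"
    unfolding e'[symmetric] by (rule IH) (use Suc.prems i in \<open>auto simp: bit_set_bit_iff reg_qubit_inj\<close>)
  \<comment> \<open>Setting bit \<open>i\<close> is a quarter turn after scaling by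
    \<open>N\<close>. It exchanges sine and cosine, so both branches contribute the same product and
    the double-angle formula applies.\<close>
  also have "N * (arccos (x j) - (e + pi / (2 * N))) = N * u - pi / 2"
    using N0 by (simp add: u_def field_simps)
  also have "sin (N * u - pi / 2) = - cos (N * u)" by (simp add: sin_diff)
  finally have IH1: "wp x (map (phase_step b j) [Suc i..<b + 1])
      (\<lambda>k. (sin (arccos (x j) - angle_est b j (b + 1) k))\<^sup>2) (set_bit (reg_qubit b j i) k) =
      (cos (N * u))\<^sup>2 / N" by simp
  have "[i..<b + 1] = i # [Suc i..<b + 1]" using i by (simp add: upt_conv_Cons)
  then have "wp x (map (phase_step b j) [i..<b + 1])
      (\<lambda>k. (sin (arccos (x j) - angle_est b j (b + 1) k))\<^sup>2) k =
     (cos (N * u))\<^sup>2 * ((sin (N * u))\<^sup>2 / N) + (sin (N * u))\<^sup>2 * ((cos (N * u))\<^sup>2 / N)"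
    by (simp only: list.map wp.simps ph IH0 IH1 starget_phase_step)
  also have "\<dots> = (2 * sin (N * u) * cos (N * u))\<^sup>2 / (2 * N)"
    using N0 by (simp add: power_mult_distrib field_simps)
  also have "\<dots> = (sin (2 * N * u))\<^sup>2 / (2 * N)"
    by (simp add: sin_double mult.assoc)
  finally show ?case by (simp only: NN u_def e_def)
qed

text \<open>A geometric series. It bounds the folded estimate and describes the effect of
  complementing all low bits.\<close>

lemma weight_sum: "(\<Sum>i<b. pi / 2 ^ (b + 1 - i)) = pi / 2 - pi / 2 ^ (b + 1)"
proof (induction b)
  case (Suc b)
  then show ?case by (simp add: sum.lessThan_Suc_shift del: sum.lessThan_Suc)
qed simp

lemma folded_est_range: "0 \<le> folded_est b j k" "folded_est b j k \<le> pi / 2"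
proof -
  have "(\<Sum>i<b. if bit k (fold_qubit b j i) then pi / 2 ^ (b + 1 - i) else 0) \<le>
      (\<Sum>i<b. pi / 2 ^ (b + 1 - i))"
    by (rule sum_mono) auto
  moreover have "pi / 2 ^ (b + 2) \<le> pi / 2 ^ (b + 1)"
    by (simp add: field_simps)
  ultimately show "folded_est b j k \<le> pi / 2"
    unfolding folded_est_def weight_sum by linarith
  show "0 \<le> folded_est b j k"
    unfolding folded_est_def by (intro add_nonneg_nonneg sum_nonneg) auto
qed

lemma cos_folded_est_nonneg: "0 \<le> cos (folded_est b j k)"
  using folded_est_range[of b j k] by (intro cos_ge_zero) auto

text \<open>If the top bit is set, the low bits of the two estimates are complementary. Their joint
  weight, the top weight \<open>pi / 2\<close> and the two half-cell offsets add up to exactly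
  \<open>pi\<close>.\<close>

lemma folded_est_cases:
  assumes "\<And>i. i < b \<Longrightarrow> bit k (fold_qubit b j i) \<longleftrightarrow> bit k (reg_qubit b j i) \<noteq> bit k (reg_qubit b j b)"
  shows "folded_est b j k = angle_est b j (b + 1) k \<or> folded_est b j k = pi - angle_est b j (b + 1) k"
proof (cases "bit k (reg_qubit b j b)")
  case False
  have "folded_est b j k = angle_est b j (b + 1) k"
    unfolding folded_est_def angle_est_def using False
    by (auto intro!: sum.cong simp: assms)
  then show ?thesis ..
next
  case True
  let ?A = "\<Sum>i<b. if bit k (fold_qubit b j i) then pi / 2 ^ (b + 1 - i) else 0"
  let ?B = "\<Sum>i<b. if bit k (reg_qubit b j i) then pi / 2 ^ (b + 1 - i) else 0"
  have "?A + ?B = (\<Sum>i<b. pi / 2 ^ (b + 1 - i))"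
    unfolding sum.distrib[symmetric] using True by (intro sum.cong) (auto simp: assms)
  moreover have "folded_est b j k = pi / 2 ^ (b + 2) + ?A"
    "angle_est b j (b + 1) k = pi / 2 ^ (b + 2) + (?B + pi / 2)"
    using True by (simp_all add: folded_est_def angle_est_def)
  moreover have "pi / 2 ^ (b + 2) + pi / 2 ^ (b + 2) = pi / 2 ^ (b + 1)" by simp
  ultimately have "folded_est b j k + angle_est b j (b + 1) k = pi"
    unfolding weight_sum by linarith
  then show ?thesis by linarith
qed

text \<open>The squared sine has period \<open>pi\<close> and cosine is even, so the reflected
  estimate is handled by comparing with \<open>- folded_est b j k\<close>.\<close>

lemma folded_error:
  assumes "\<And>i. i < b \<Longrightarrow> bit k (fold_qubit b j i) \<longleftrightarrow> bit k (reg_qubit b j i) \<noteq> bit k (reg_qubit b j b)"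
    and x: "0 \<le> x j" "x j \<le> 1"
  shows "(x j - cos (folded_est b j k))\<^sup>2 \<le> (sin (arccos (x j) - angle_est b j (b + 1) k))\<^sup>2"
proof -
  define t where "t = arccos (x j)"
  have t: "x j = cos t" using x by (simp add: t_def)
  note c = cos_folded_est_nonneg[of b j k]
  from folded_est_cases[OF assms(1)] show ?thesis
  proof
    assume "folded_est b j k = angle_est b j (b + 1) k"
    then show ?thesis
      using cos_diff_square_le[of t "folded_est b j k"] x c
      unfolding t_def[symmetric] unfolding t by simp
  next
    assume "folded_est b j k = pi - angle_est b j (b + 1) k"
    then have e: "angle_est b j (b + 1) k = pi - folded_est b j k" by simp
    have "(sin (t - (pi - folded_est b j k)))\<^sup>2 = (sin (t - (- folded_est b j k)))\<^sup>2"
      using sin_minus_pi[of "t + folded_est b j k"] by (simp add: algebra_simps)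
    then show ?thesis
      using cos_diff_square_le[of t "- folded_est b j k"] x c
      unfolding e t_def[symmetric] unfolding t by simp
  qed
qed

text \<open>Each fold step has one branch of probability 1, leading to \<open>k'\<close> below. The
  invariant is that fold bits below \<open>i\<close> are already computed while those from
  \<open>i\<close> on are still 0.\<close>

lemma wp_fold_steps:
  assumes "i \<le> b"
    "\<And>i'. i' < i \<Longrightarrow> bit k (fold_qubit b j i') \<longleftrightarrow> bit k (reg_qubit b j i') \<noteq> bit k (reg_qubit b j b)"
    "\<And>i'. i \<le> i' \<Longrightarrow> i' < b \<Longrightarrow> \<not> bit k (fold_qubit b j i')"
    and x: "0 \<le> x j" "x j \<le> 1"
  shows "wp x (map (fold_step b j) [i..<b]) (\<lambda>k. (x j - cos (folded_est b j k))\<^sup>2) k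
    \<le> (sin (arccos (x j) - angle_est b j (b + 1) k))\<^sup>2"
  using assms(1-3)
proof (induction "b - i" arbitrary: i k)
  case 0
  then show ?case using folded_error[of b k j x] x by simp
next
  case (Suc m)
  from Suc.hyps(2) have i: "i < b" by auto
  let ?G = "\<lambda>k. (x j - cos (folded_est b j k))\<^sup>2"
  let ?q = "fold_qubit b j i"
  define v where "v \<longleftrightarrow> bit k (reg_qubit b j i) \<noteq> bit k (reg_qubit b j b)"
  define k' where "k' = (if v then set_bit ?q k else k)"
  have bm: "bit k' (reg_qubit b j i') = bit k (reg_qubit b j i')" if "i' \<le> b" for i'
    using that i by (auto simp: k'_def bit_set_bit_iff fold_qubit_def reg_qubit_inj)
  have bf: "bit k' (fold_qubit b j i') = (if i' = i then v else bit k (fold_qubit b j i'))" if "i' < b" for i'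
    using that i Suc.prems(3)[of i] by (auto simp: k'_def bit_set_bit_iff fold_qubit_def reg_qubit_inj)
  have "[i..<b] = i # [Suc i..<b]" using i by (simp add: upt_conv_Cons)
  then have "wp x (map (fold_step b j) [i..<b]) ?G k = wp x (map (fold_step b j) [Suc i..<b]) ?G k'"
    by (simp add: step_phase_def fold_step_def v_def k'_def)
  also have "\<dots> \<le> (sin (arccos (x j) - angle_est b j (b + 1) k'))\<^sup>2"
    by (rule Suc.hyps(1)) (use Suc.hyps(2) Suc.prems i in \<open>auto simp: bm bf v_def less_Suc_eq\<close>)
  also have "angle_est b j (b + 1) k' = angle_est b j (b + 1) k"
    unfolding angle_est_def by (auto intro!: sum.cong simp: bm)
  finally show ?case .
qed

text \<open>Folding does not increase the error beyond the squared sine, whose expectation under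
  phase estimation with \<open>2 ^ (b + 1)\<close> grid points is at most one over their
  number.\<close>

lemma wp_block:
  assumes "\<And>i. i < 2 * b + 1 \<Longrightarrow> \<not> bit k (reg_qubit b j i)" "0 \<le> x j" "x j \<le> 1"
  shows "wp x (block b j) (\<lambda>k. (x j - cos (folded_est b j k))\<^sup>2) k \<le> 1 / 2 ^ (b + 1)"
proof -
  have "wp x (block b j) (\<lambda>k. (x j - cos (folded_est b j k))\<^sup>2) k \<le>
    wp x (map (phase_step b j) [0..<b + 1]) (\<lambda>k. (sin (arccos (x j) - angle_est b j (b + 1) k))\<^sup>2) k"
    unfolding block_def wp_append
  proof (rule wp_mono)
    fix k' :: nat assume *: "\<And>q. bit k' q \<Longrightarrow> bit k q \<or> q \<in> starget ` set (map (phase_step b j) [0..<b + 1])"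
    have "\<not> bit k' (fold_qubit b j i)" if "i < b" for i
      using that *[of "fold_qubit b j i"] assms(1)[of "b + 1 + i"]
      by (auto simp: fold_qubit_def reg_qubit_inj)
    then show "wp x (map (fold_step b j) [0..<b]) (\<lambda>k. (x j - cos (folded_est b j k))\<^sup>2) k'
        \<le> (sin (arccos (x j) - angle_est b j (b + 1) k'))\<^sup>2"
      using assms by (intro wp_fold_steps) auto
  qed
  also have "\<dots> = (sin (2 ^ (b + 1) * (arccos (x j) - angle_est b j (b + 1) k)))\<^sup>2 / 2 ^ (b + 1)"
    by (subst wp_phase_steps) (use assms(1) in auto)
  also have "\<dots> \<le> 1 / 2 ^ (b + 1)"
    by (intro divide_right_mono) (auto simp: abs_square_le_1)
  finally show ?thesis .
qed

section \<open>Blocks for different coordinates on disjoint qubits\<close>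

lemma map_plus_upt: "map ((+) n) [0..<m] = [n..<n + m]"
proof -
  have "(+) n = (\<lambda>i. i + n)" by auto
  then show ?thesis using map_add_upt[of n m] by (simp add: add.commute)
qed

lemma upt_append_shift: "[0..<m + n] = [0..<m] @ map ((+) m) [0..<n]"
  using upt_add_eq_append[of 0 m n] by (simp add: map_plus_upt)

lemma map_starget_block: "map starget (block b j) = map (reg_qubit b j) [0..<2 * b + 1]"
proof -
  have "2 * b + 1 = (b + 1) + b" by simp
  then have "[0..<2 * b + 1] = [0..<b + 1] @ map ((+) (b + 1)) [0..<b]"
    by (simp only: upt_append_shift)
  then show ?thesis by (simp add: block_def fold_qubit_def comp_def del: upt_Suc)
qed

text \<open>The blocks fill the qubits from 1 on without gaps or repetitions; this yields distinct
  targets and leaves qubit 0 untouched.\<close>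

lemma starget_blocks: "map starget (concat (map (block b) [0..<d])) = [1..<1 + d * (2 * b + 1)]"
proof (induction d)
  case (Suc d)
  define M where "M = 2 * b + 1"
  have "reg_qubit b d = (+) (1 + d * M)"
    by (auto simp: reg_qubit_def M_def)
  then have "map (reg_qubit b d) [0..<M] = [1 + d * M..<1 + d * M + M]"
    by (simp only: map_plus_upt)
  moreover have "[1..<1 + Suc d * M] = [1..<1 + d * M] @ [1 + d * M..<1 + d * M + M]"
    using upt_add_eq_append[of 1 "1 + d * M" M] by (simp add: algebra_simps)
  moreover have "[0..<Suc d] = [0..<d] @ [d]" by simp
  ultimately show ?case
    using Suc unfolding M_def[symmetric]
    by (simp add: map_starget_block[of b, folded M_def] del: mult_Suc upt_Suc)
qed simp

lemma starget_block: "starget ` set (block b j) = reg_qubit b j ` {..<2 * b + 1}"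
  using arg_cong[OF map_starget_block[of b j], of set]
  unfolding set_map set_upt atLeast0LessThan .

lemma depends_only_folded_est: "depends_only (fold_qubit b j ` {..<b}) (\<lambda>k. g (folded_est b j k))"
  unfolding folded_est_def
  by (rule depends_onlyI) (auto intro!: arg_cong[where f = g] sum.cong)

text \<open>Blocks after \<open>j\<close> do not write the folded bits of \<open>j\<close>, and
  blocks before \<open>j\<close> leave its register at 0, so the bound for a single block carries
  over.\<close>

lemma wp_blocks:
  assumes j: "j < d" and x: "0 \<le> x j" "x j \<le> 1"
  shows "wp x (concat (map (block b) [0..<d])) (\<lambda>k. (x j - cos (folded_est b j k))\<^sup>2) 0 \<le> 1 / 2 ^ (b + 1)"
proof -
  let ?G = "\<lambda>k. (x j - cos (folded_est b j k))\<^sup>2"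
  have "[0..<d] = [0..<j] @ j # [Suc j..<d]"
    using j upt_add_eq_append[of 0 j "d - j"] by (simp add: upt_conv_Cons)
  then have "wp x (concat (map (block b) [0..<d])) ?G 0 =
    wp x (concat (map (block b) [0..<j])) (wp x (block b j) (wp x (concat (map (block b) [Suc j..<d])) ?G)) 0"
    by (simp add: wp_append)
  also have "wp x (concat (map (block b) [Suc j..<d])) ?G = ?G"
    by (intro ext wp_irrelevant[OF depends_only_folded_est])
      (auto simp: image_UN starget_block fold_qubit_def reg_qubit_inj)
  also have "wp x (concat (map (block b) [0..<j])) (wp x (block b j) ?G) 0 \<le>
      wp x (concat (map (block b) [0..<j])) (\<lambda>_. 1 / 2 ^ (b + 1)) 0"
  proof (intro wp_mono wp_block)
    fix k' i :: nat assume "\<And>q. bit k' q \<Longrightarrow> bit (0::nat) q \<or> q \<in> starget ` set (concat (map (block b) [0..<j]))"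
      and i: "i < 2 * b + 1"
    then have "bit k' (reg_qubit b j i) \<Longrightarrow> \<exists>j'<j. reg_qubit b j i \<in> starget ` set (block b j')"
      by (fastforce simp: image_UN)
    with i show "\<not> bit k' (reg_qubit b j i)"
      unfolding starget_block by (auto simp: reg_qubit_inj)
  qed (use x in auto)
  finally show ?thesis by (simp only: wp_const)
qed

section \<open>Read-out of the function value\<close>

definition read_out :: "nat \<Rightarrow> nat \<Rightarrow> nat \<Rightarrow> nat \<Rightarrow> real" where
  "read_out b d k = (\<lambda>j. if j < d then cos (folded_est b j k) else 0)"

text \<open>The output bit is 0 with probability \<open>(cos (arccos y / 2))\<^sup>2\<close> for
  \<open>y = f (read_out b d k)\<close>, so Z has expectation \<open>cos (arccos y) = y\<close>.
  Controlling on the folded bits only keeps the table at \<open>(2 ^ b) ^ d\<close> angles.\<close>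

definition out_step :: "nat \<Rightarrow> nat \<Rightarrow> ((nat \<Rightarrow> real) \<Rightarrow> real) \<Rightarrow> step" where
  "out_step b d f = Step 0 0 0 (concat (map (\<lambda>j. map (fold_qubit b j) [0..<b]) [0..<d]))
     (\<lambda>k. arccos (f (read_out b d k)))"

definition approx_steps :: "nat \<Rightarrow> nat \<Rightarrow> ((nat \<Rightarrow> real) \<Rightarrow> real) \<Rightarrow> step list" where
  "approx_steps b d f = concat (map (block b) [0..<d]) @ [out_step b d f]"

lemma read_out_cube: "read_out b d k \<in> unit_cube d"
  by (simp add: unit_cube_def read_out_def cos_folded_est_nonneg)

lemma reg_qubit_less:
  assumes "j < d" "i < 2 * b + 1"
  shows "reg_qubit b j i < 1 + d * (2 * b + 1)"
proof -
  define M where "M = 2 * b + 1"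
  have "(j + 1) * M \<le> d * M"
    using assms(1) by (intro mult_right_mono) auto
  then show ?thesis
    using assms(2) unfolding reg_qubit_def M_def[symmetric] by simp
qed

lemma depends_only_mono: "depends_only S \<alpha> \<Longrightarrow> S \<subseteq> T \<Longrightarrow> depends_only T \<alpha>"
  unfolding depends_only_def by blast

lemma wf_phase_step: "j < d \<Longrightarrow> i \<le> b \<Longrightarrow> wf_step (1 + d * (2 * b + 1)) d (phase_step b j i)"
  unfolding wf_step_def phase_step_def angle_est_def
  by (auto simp: reg_qubit_inj intro!: reg_qubit_less[simplified] depends_onlyI sum.cong)

lemma wf_fold_step: "j < d \<Longrightarrow> i < b \<Longrightarrow> wf_step (1 + d * (2 * b + 1)) d (fold_step b j i)"
  unfolding wf_step_def fold_step_def fold_qubit_def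
  by (auto simp: reg_qubit_inj intro!: reg_qubit_less[simplified] depends_onlyI)

lemma read_out_cong:
  assumes "\<And>j i. j < d \<Longrightarrow> i < b \<Longrightarrow> bit k (fold_qubit b j i) = bit k' (fold_qubit b j i)"
  shows "read_out b d k = read_out b d k'"
  unfolding read_out_def folded_est_def
  by (rule ext) (auto intro!: arg_cong[where f = cos] sum.cong simp: assms)

lemma wf_out_step:
  assumes "d \<ge> 1"
  shows "wf_step (1 + d * (2 * b + 1)) d (out_step b d f)"
proof -
  have "depends_only (\<Union>j<d. fold_qubit b j ` {..<b}) (\<lambda>k. arccos (f (read_out b d k)))"
    by (intro depends_onlyI arg_cong[where f = "\<lambda>y. arccos (f y)"] read_out_cong) auto
  then have dep: "depends_only (set (concat (map (\<lambda>j. map (fold_qubit b j) [0..<b]) [0..<d])))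
      (\<lambda>k. arccos (f (read_out b d k)))"
    by (rule depends_only_mono) auto
  have less: "fold_qubit b j i < 1 + d * (2 * b + 1)" if "j < d" "i < b" for i j
    unfolding fold_qubit_def using that by (intro reg_qubit_less) auto
  have pos: "fold_qubit b j i \<noteq> 0" for i j
    by (simp add: fold_qubit_def reg_qubit_def)
  show ?thesis
    unfolding wf_step_def out_step_def step.sel
  proof (intro conjI ballI dep)
    fix c assume "c \<in> set (concat (map (\<lambda>j. map (fold_qubit b j) [0..<b]) [0..<d]))"
    then obtain j i where "j < d" "i < b" "c = fold_qubit b j i" by auto
    then show "c < 1 + d * (2 * b + 1)" using less by blast
  qed (use assms in \<open>auto simp: pos\<close>)
qed

lemma wf_approx_steps:
  assumes "d \<ge> 1" "s \<in> set (approx_steps b d f)"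
  shows "wf_step (1 + d * (2 * b + 1)) d s"
proof -
  have "wf_step (1 + d * (2 * b + 1)) d s" if "j < d" "s \<in> set (block b j)" for j
    using that unfolding block_def by (auto simp: wf_phase_step[simplified] wf_fold_step[simplified] less_Suc_eq_le)
  then show ?thesis
    using assms wf_out_step[OF assms(1), of b f] unfolding approx_steps_def by auto
qed

lemma distinct_approx_steps: "distinct (map starget (approx_steps b d f))"
  unfolding approx_steps_def map_append starget_blocks by (simp add: out_step_def del: upt_Suc)

lemma approx_output:
  assumes d: "d \<ge> 1" and f: "\<And>y. y \<in> unit_cube d \<Longrightarrow> \<bar>f y\<bar> \<le> 1" and x: "x \<in> unit_cube d"
  shows "pqc_output (1 + d * (2 * b + 1)) (concat (map step_circ (approx_steps b d f))) x
    = wp x (concat (map (block b) [0..<d])) (\<lambda>k. f (read_out b d k)) 0"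
proof -
  let ?Z = "\<lambda>k::nat. if bit k 0 then -1 else 1 :: real"
  have "pqc_output (1 + d * (2 * b + 1)) (concat (map step_circ (approx_steps b d f))) x =
      wp x (approx_steps b d f) ?Z 0"
  proof (rule pqc_output_steps)
    show "- 1 \<le> x j \<and> x j \<le> 1" if "j < d" for j
      using that x by (force simp: unit_cube_def)
  qed (use wf_approx_steps[OF d] distinct_approx_steps in auto)
  also have "\<dots> = wp x (concat (map (block b) [0..<d])) (wp x [out_step b d f] ?Z) 0"
    by (simp only: approx_steps_def wp_append)
  also have "\<dots> = wp x (concat (map (block b) [0..<d])) (\<lambda>k. f (read_out b d k)) 0"
  proof (rule wp_cong)
    fix k :: nat
    assume "\<And>q. bit k q \<Longrightarrow> bit (0::nat) q \<or> q \<in> starget ` set (concat (map (block b) [0..<d]))"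
    \<comment> \<open>Block targets start at 1, so the output qubit is still 0 here.\<close>
    then have "\<not> bit k 0"
      using arg_cong[OF starget_blocks[of b d], of set] by fastforce
    then have "wp x [out_step b d f] ?Z k = cos (2 * (arccos (f (read_out b d k)) / 2))"
      unfolding cos_double by (simp add: step_phase_def out_step_def bit_set_bit_iff)
    also have "\<dots> = f (read_out b d k)"
      using f[OF read_out_cube, of b k] by simp
    finally show "wp x [out_step b d f] ?Z k = f (read_out b d k)" .
  qed
  finally show ?thesis .
qed

section \<open>From mean squared error to uniform error\<close>

text \<open>Chebyshev-type bound: where the Lipschitz estimate fails to give \<open>\<epsilon>\<close>, the squared distance
  already exceeds \<open>(\<epsilon> / L)\<^sup>2\<close> and the trivial bound 2 applies.\<close>
lemma lipschitz_quadratic_bound: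
  fixes f :: "(nat \<Rightarrow> real) \<Rightarrow> real"
  assumes "\<epsilon> > 0" "\<bar>f x\<bar> \<le> 1" "\<bar>f y\<bar> \<le> 1" "\<bar>f x - f y\<bar> \<le> L * dist_inf d x y"
  shows "\<bar>f x - f y\<bar> \<le> \<epsilon> + 2 * L\<^sup>2 / \<epsilon>\<^sup>2 * (\<Sum>j<d. (x j - y j)\<^sup>2)"
proof (cases "L * dist_inf d x y \<le> \<epsilon>")
  case True
  have "0 \<le> 2 * L\<^sup>2 / \<epsilon>\<^sup>2 * (\<Sum>j<d. (x j - y j)\<^sup>2)"
    by (intro mult_nonneg_nonneg sum_nonneg) auto
  with True assms(4) show ?thesis by linarith
next
  case False
  have "dist_inf d x y \<in> insert 0 ((\<lambda>i. \<bar>x i - y i\<bar>) ` {..<d})"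
    unfolding dist_inf_def by (rule Max_in) auto
  with False assms(1) obtain j where j: "j < d" and D: "dist_inf d x y = \<bar>x j - y j\<bar>" by auto
  have "\<epsilon>\<^sup>2 \<le> (L * \<bar>x j - y j\<bar>)\<^sup>2"
    using False assms(1) unfolding D by (intro power_mono) auto
  also have "\<dots> = L\<^sup>2 * (x j - y j)\<^sup>2" by (simp add: power_mult_distrib)
  also have "\<dots> \<le> L\<^sup>2 * (\<Sum>j<d. (x j - y j)\<^sup>2)"
    by (intro mult_left_mono member_le_sum) (use j in auto)
  finally have "1 \<le> L\<^sup>2 / \<epsilon>\<^sup>2 * (\<Sum>j<d. (x j - y j)\<^sup>2)"
    using assms(1) by (simp add: field_simps)
  moreover have "\<bar>f x - f y\<bar> \<le> 2" using assms(2,3) by linarith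
  moreover have "2 * L\<^sup>2 / \<epsilon>\<^sup>2 * (\<Sum>j<d. (x j - y j)\<^sup>2) = 2 * (L\<^sup>2 / \<epsilon>\<^sup>2 * (\<Sum>j<d. (x j - y j)\<^sup>2))"
    by simp
  ultimately show ?thesis using assms(1) by linarith
qed

lemma approx_error:
  fixes f :: "(nat \<Rightarrow> real) \<Rightarrow> real"
  assumes d: "d \<ge> 1" and \<epsilon>: "\<epsilon> > 0"
    and f: "\<And>y. y \<in> unit_cube d \<Longrightarrow> \<bar>f y\<bar> \<le> 1"
    and lip: "\<And>x y. x \<in> unit_cube d \<Longrightarrow> y \<in> unit_cube d \<Longrightarrow> \<bar>f x - f y\<bar> \<le> L * dist_inf d x y"
    and x: "x \<in> unit_cube d"
  shows "\<bar>f x - pqc_output (1 + d * (2 * b + 1)) (concat (map step_circ (approx_steps b d f))) x\<bar>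
    \<le> \<epsilon> + 2 * real d * (L\<^sup>2 / (2 ^ (b + 1) * \<epsilon>\<^sup>2))"
proof -
  let ?ss = "concat (map (block b) [0..<d])"
  define c where "c = 2 * L\<^sup>2 / \<epsilon>\<^sup>2"
  define S where "S = (\<lambda>k. \<Sum>j<d. (x j - cos (folded_est b j k))\<^sup>2)"
  define F where "F = (\<lambda>k. f (read_out b d k))"
  have S_eq: "(\<Sum>j<d. (x j - read_out b d k j)\<^sup>2) = S k" for k
    unfolding S_def read_out_def by (intro sum.cong) auto
  have bound: "\<bar>f x - F k\<bar> \<le> \<epsilon> + c * S k" for k
    using lipschitz_quadratic_bound[OF \<epsilon> f[OF x] f[OF read_out_cube] lip[OF x read_out_cube], of b k]
    unfolding S_eq F_def c_def .
  have "wp x ?ss S 0 = (\<Sum>j<d. wp x ?ss (\<lambda>k. (x j - cos (folded_est b j k))\<^sup>2) 0)"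
    unfolding S_def by (rule wp_sum)
  also have "\<dots> \<le> (\<Sum>j<d. 1 / 2 ^ (b + 1))"
    by (intro sum_mono wp_blocks) (use x in \<open>auto simp: unit_cube_def\<close>)
  finally have S: "c * wp x ?ss S 0 \<le> c * (real d / 2 ^ (b + 1))"
    by (intro mult_left_mono) (auto simp: c_def)
  \<comment> \<open>The absolute value is split into two affine bounds in \<open>S\<close>, through
    which \<open>wp\<close> passes exactly.\<close>
  have "F k \<le> (f x + \<epsilon>) + c * S k" "(f x - \<epsilon>) + (- c) * S k \<le> F k" for k
    using bound[of k] by linarith+
  then have "wp x ?ss F 0 \<le> wp x ?ss (\<lambda>k. (f x + \<epsilon>) + c * S k) 0"
    "wp x ?ss (\<lambda>k. (f x - \<epsilon>) + (- c) * S k) 0 \<le> wp x ?ss F 0"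
    by (intro wp_mono; blast)+
  with S have "\<bar>f x - wp x ?ss F 0\<bar> \<le> \<epsilon> + c * (real d / 2 ^ (b + 1))"
    unfolding wp_affine by linarith
  also have "c * (real d / 2 ^ (b + 1)) = 2 * real d * (L\<^sup>2 / (2 ^ (b + 1) * \<epsilon>\<^sup>2))"
    by (simp add: c_def field_simps)
  also have "wp x ?ss F 0 = pqc_output (1 + d * (2 * b + 1)) (concat (map step_circ (approx_steps b d f))) x"
    unfolding F_def by (rule approx_output[OF d _ x, symmetric]) (rule f)
  finally show ?thesis .
qed

section \<open>Resources\<close>

text \<open>The length \<open>l\<close> obeys \<open>l' = 2 * l + 2\<close>, so \<open>l + 2\<close>
  doubles with every control, starting from 3.\<close>

lemma length_uc_rz: "length (uc_rz cs q \<alpha>) + 2 = 3 * 2 ^ length cs"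
proof (induction cs arbitrary: \<alpha>)
  case (Cons c cs)
  from Cons[of "\<lambda>k. (\<alpha> (unset_bit c k) + \<alpha> (set_bit c k)) / 2"]
    Cons[of "\<lambda>k. (\<alpha> (unset_bit c k) - \<alpha> (set_bit c k)) / 2"]
  show ?case by simp
qed simp

lemma length_step_circ: "length (step_circ s) = sreps s + 3 * 2 ^ length (sctrls s)"
  using length_uc_rz[of "sctrls s" "starget s" "sangle s"] by (simp add: step_circ_def)

text \<open>Encoding and controlled gates of the phase steps form geometric series with total at
  most \<open>8 * 2 ^ b\<close>. The fold steps cost 12 gates each, and
  \<open>b \<le> 2 ^ b\<close>.\<close>

lemma length_block: "length (concat (map step_circ (block b j))) \<le> 20 * 2 ^ b"
proof -
  have p: "(\<Sum>i<m. (2::nat) ^ i) + 1 = 2 ^ m" for m by (induction m) auto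
  have r: "(\<Sum>i<b + 1. (2::nat) ^ (b - i)) = (\<Sum>i<b + 1. 2 ^ i)"
    using sum.nat_diff_reindex[of "\<lambda>i. (2::nat) ^ i" "b + 1"] by simp
  have "length (concat (map step_circ (map (phase_step b j) [0..<b + 1]))) =
      (\<Sum>i<b + 1. 2 ^ (b - i) + 3 * 2 ^ i)"
    by (simp add: length_concat comp_def length_step_circ phase_step_def interv_sum_list_conv_sum_set_nat
        atLeast0LessThan del: upt_Suc sum.lessThan_Suc)
  also have "\<dots> = (\<Sum>i<b + 1. 2 ^ (b - i)) + 3 * (\<Sum>i<b + 1. 2 ^ i)"
    by (simp only: sum.distrib sum_distrib_left)
  also have "\<dots> = 4 * (\<Sum>i<b + 1. 2 ^ i)" unfolding r by simp
  also have "\<dots> \<le> 8 * 2 ^ b" using p[of "b + 1"] by simp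
  finally have 1: "length (concat (map step_circ (map (phase_step b j) [0..<b + 1]))) \<le> 8 * 2 ^ b" .
  have "length (concat (map step_circ (map (fold_step b j) [0..<b]))) = 12 * b"
    by (simp add: length_concat comp_def length_step_circ fold_step_def sum_list_triv)
  moreover have "b \<le> 2 ^ b" by (simp add: less_imp_le)
  ultimately show ?thesis using 1
    unfolding block_def map_append concat_append length_append by linarith
qed

lemma length_approx_steps:
  "length (concat (map step_circ (approx_steps b d f))) \<le> d * (20 * 2 ^ b) + 3 * (2 ^ b) ^ d"
proof -
  have "length (concat (map step_circ (concat (map (block b) [0..<d])))) \<le> d * (20 * 2 ^ b)"
  proof (induction d)
    case (Suc d)
    then show ?case using length_block[of b d] by simp
  qed simp
  moreover have "length (step_circ (out_step b d f)) = 3 * (2 ^ b) ^ d"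
    by (simp add: length_step_circ out_step_def length_concat comp_def sum_list_triv power_mult mult.commute)
  ultimately show ?thesis by (simp add: approx_steps_def)
qed

lemma wf_uc_rz:
  assumes "q < w" "\<And>c. c \<in> set cs \<Longrightarrow> c < w" "q \<notin> set cs" "g \<in> set (uc_rz cs q \<alpha>)"
  shows "wf_gate w d g"
  using assms(2-4)
proof (induction cs arbitrary: \<alpha>)
  case (Cons c cs)
  then show ?case using assms(1) by (auto simp: wf_gate_def gate_qubits_def)
qed (use assms(1) in \<open>auto simp: wf_gate_def gate_qubits_def\<close>)

lemma wf_step_circ:
  assumes "wf_step w d s" "g \<in> set (step_circ s)"
  shows "wf_gate w d g"
  using assms wf_uc_rz[of "starget s" w "sctrls s" g "sangle s" d]
  by (auto simp: step_circ_def wf_step_def wf_gate_def gate_qubits_def)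

text \<open>Each gate raises the highest layer by at most one.\<close>

lemma circuit_depth_le_length: "circuit_depth w c \<le> length c"
proof -
  have "foldl layer_step L c q \<le> m + length c" if "\<And>q. L q \<le> m" for L m q
    using that
  proof (induction c arbitrary: L m)
    case (Cons g c)
    have ne: "gate_qubits g \<noteq> {}" "finite (gate_qubits g)"
      by (cases g; simp add: gate_qubits_def)+
    then have "Max (L ` gate_qubits g) \<le> m" using Cons.prems by (subst Max_le_iff) auto
    then have "layer_step L g p \<le> Suc m" for p
      using Cons.prems[of p] by (auto simp: layer_step_def Let_def)
    from Cons.IH[OF this] show ?case by simp
  qed simp
  from this[of "\<lambda>_. 0" 0] show ?thesis
    unfolding circuit_depth_def by (subst Max_le_iff) auto
qed

lemma num_params_le_length: "num_params c \<le> length c"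
  by (simp add: num_params_def)

section \<open>Choice of the resolution and final bounds\<close>

theorem theorem2:
  shows "\<exists>C::real. C > 0 \<and>
    (\<forall>(d::nat) (L::real) (f::(nat \<Rightarrow> real) \<Rightarrow> real) (\<epsilon>::real) (n::nat).
       d \<ge> 1 \<longrightarrow> n \<ge> 1 \<longrightarrow> \<epsilon> > 0 \<longrightarrow>
       (\<forall>x\<in>unit_cube d. \<bar>f x\<bar> \<le> 1) \<longrightarrow>
       (\<forall>x\<in>unit_cube d. \<forall>y\<in>unit_cube d. \<bar>f x - f y\<bar> \<le> L * dist_inf d x y) \<longrightarrow>
       (\<exists>(w::nat) (c::gate list). wf_pqc w d c \<and>
          (\<forall>x\<in>unit_cube d.
             \<bar>f x - pqc_output w c x\<bar> \<le> \<epsilon> + 2 * ((1 + L\<^sup>2 / (real n * \<epsilon>\<^sup>2)) ^ d - 1) \<and>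
             \<bar>f x - pqc_output w c x\<bar> \<le> \<epsilon> + real d * 2 ^ d * L\<^sup>2 / (real n * \<epsilon>\<^sup>2)) \<and>
          real w \<le> C * real d * (1 + log 2 (real n)) \<and>
          real (circuit_depth w c) \<le> C * real d * real n ^ d * (1 + log 2 (real n)) \<and>
          real (num_params c) \<le> C * real d * real n ^ d))"
\<comment> \<open>The constant is 20 for the blocks plus 3 for the output table.\<close>
proof (intro exI[of _ "23::real"] conjI allI impI)
  fix d :: nat and L \<epsilon> :: real and f :: "(nat \<Rightarrow> real) \<Rightarrow> real" and n :: nat
  assume d: "1 \<le> d" and n: "1 \<le> n" and \<epsilon>: "0 < \<epsilon>"
    and f: "\<forall>x\<in>unit_cube d. \<bar>f x\<bar> \<le> 1"
    and lip: "\<forall>x\<in>unit_cube d. \<forall>y\<in>unit_cube d. \<bar>f x - f y\<bar> \<le> L * dist_inf d x y"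
  \<comment> \<open>The upper bound on \<open>n\<close> serves the error estimate, the lower bound
    \<open>2 ^ b \<le> n\<close> the resources.\<close>
  obtain b where b: "2 ^ b \<le> n" "n < 2 ^ (b + 1)"
    using ex_power_ivl1[of 2 n] n by auto
  define w where "w = 1 + d * (2 * b + 1)"
  define c where "c = concat (map step_circ (approx_steps b d f))"
  define t where "t = L\<^sup>2 / (real n * \<epsilon>\<^sup>2)"
  have t: "0 \<le> t" by (simp add: t_def)
  have "wf_pqc w d c"
    unfolding wf_pqc_def c_def w_def using wf_step_circ wf_approx_steps[OF d] by fastforce
  moreover have "\<bar>f x - pqc_output w c x\<bar> \<le> \<epsilon> + 2 * ((1 + t) ^ d - 1) \<and>
      \<bar>f x - pqc_output w c x\<bar> \<le> \<epsilon> + real d * 2 ^ d * t" if x: "x \<in> unit_cube d" for x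
  proof -
    have "real n \<le> 2 ^ (b + 1)" using b(2) by (metis less_imp_le of_nat_le_iff of_nat_numeral of_nat_power)
    then have "L\<^sup>2 / (2 ^ (b + 1) * \<epsilon>\<^sup>2) \<le> t"
      unfolding t_def using n \<epsilon> by (intro divide_left_mono mult_right_mono mult_pos_pos) auto
    then have "2 * real d * (L\<^sup>2 / (2 ^ (b + 1) * \<epsilon>\<^sup>2)) \<le> 2 * real d * t"
      by (intro mult_left_mono) auto
    with approx_error[OF d \<epsilon> _ _ x, of f L b] f lip
    have err: "\<bar>f x - pqc_output w c x\<bar> \<le> \<epsilon> + 2 * real d * t"
      unfolding w_def c_def by fastforce
    \<comment> \<open>Bernoulli's inequality gives the first required bound; the second follows from
      \<open>2 \<le> 2 ^ d\<close>.\<close>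
    have "1 + real d * t \<le> (1 + t) ^ d"
      using t by (intro Bernoulli_inequality) auto
    moreover have "2 * real d * t \<le> real d * 2 ^ d * t"
    proof -
      have "(2::real) ^ 1 \<le> 2 ^ d" using d by (intro power_increasing) auto
      then have "2 * (real d * t) \<le> 2 ^ d * (real d * t)"
        using t by (intro mult_right_mono) auto
      then show ?thesis by (simp add: mult_ac)
    qed
    ultimately show ?thesis using err by auto
  qed
  moreover have lg: "real b \<le> log 2 (real n)"
    using b(1) n by (intro le_log_of_power) (auto simp flip: of_nat_le_iff)
  have "real w \<le> 23 * real d * (1 + log 2 (real n))"
  proof -
    have "real w = 1 + real d * (2 * real b + 1)" by (simp add: w_def algebra_simps)
    also have "\<dots> \<le> real d + real d * (2 * real b + 1)" using d by simp
    also have "\<dots> = real d * (2 * real b + 2)" by (simp add: algebra_simps)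
    also have "\<dots> \<le> real d * (23 * (1 + log 2 (real n)))"
      using lg by (intro mult_left_mono) auto
    finally show ?thesis by (simp add: mult_ac)
  qed
  moreover have len: "real (length c) \<le> 23 * real d * real n ^ d"
  proof -
    have "length c \<le> d * (20 * 2 ^ b) + 3 * (2 ^ b) ^ d"
      unfolding c_def by (rule length_approx_steps)
    \<comment> \<open>As \<open>d\<close> is positive, \<open>2 ^ b \<le> n \<le> n ^ d\<close>, and
      the table term may be multiplied by \<open>d\<close> to merge with the block term.\<close>
    also have "\<dots> \<le> d * (20 * n ^ d) + (3 * n ^ d) * d"
    proof (intro add_mono mult_left_mono)
      show "2 ^ b \<le> n ^ d" using b(1) self_le_power[OF n, of d] d by linarith
      have "3 * (2 ^ b) ^ d \<le> 3 * n ^ d" using b(1) by (intro mult_left_mono power_mono) auto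
      also have "\<dots> \<le> 3 * n ^ d * d" using d by simp
      finally show "3 * (2 ^ b) ^ d \<le> 3 * n ^ d * d" .
    qed auto
    also have "\<dots> = 23 * d * n ^ d" by simp
    finally have "real (length c) \<le> real (23 * d * n ^ d)" by (simp only: of_nat_le_iff)
    then show ?thesis by simp
  qed
  moreover have "real (circuit_depth w c) \<le> 23 * real d * real n ^ d * (1 + log 2 (real n))"
  proof -
    have "real (circuit_depth w c) \<le> 23 * real d * real n ^ d * 1"
      using circuit_depth_le_length[of w c] len by simp
    also have "\<dots> \<le> 23 * real d * real n ^ d * (1 + log 2 (real n))"
      using lg by (intro mult_left_mono) auto
    finally show ?thesis .
  qed
  moreover have "real (num_params c) \<le> 23 * real d * real n ^ d"
    using num_params_le_length[of c] len by simp
  ultimately show "\<exists>w c. wf_pqc w d c \<and>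
      (\<forall>x\<in>unit_cube d.
         \<bar>f x - pqc_output w c x\<bar> \<le> \<epsilon> + 2 * ((1 + L\<^sup>2 / (real n * \<epsilon>\<^sup>2)) ^ d - 1) \<and>
         \<bar>f x - pqc_output w c x\<bar> \<le> \<epsilon> + real d * 2 ^ d * L\<^sup>2 / (real n * \<epsilon>\<^sup>2)) \<and>
      real w \<le> 23 * real d * (1 + log 2 (real n)) \<and>
      real (circuit_depth w c) \<le> 23 * real d * real n ^ d * (1 + log 2 (real n)) \<and>
      real (num_params c) \<le> 23 * real d * real n ^ d"
    unfolding t_def times_divide_eq_right by blast
qed simp

end
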